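(* Let $X$ and $Y$ be infinite dimensional complex Banach spaces, and suppose $S\in L(X)$ and $T\in L(Y)$ satisfy $\sigma_p^0(S)=\sigma_p^0(T)$. If property $(z)$ holds for $S$ and for $T$, then property $(z)$ holds for $S\oplus T\in L(X\oplus Y)$ if and only if $\sigma_{uw}(S\oplus T)=\sigma_{uw}(S)\cup\sigma_{uw}(T)$.
   Context: $L(X)$ is the algebra of bounded linear operators on $X$. For a bounded operator $T$: $R(T)$ is the range, $\alpha(T)=\dim\ker T$, $\beta(T)=\operatorname{codim} R(T)$; $\sigma(T)$ is the spectrum and $\sigma_a(T)$ the approximate point spectrum; $\mathrm{iso}\,A$ is the set of isolated points of $A\subset\mathbb{C}$. $T$ is upper semi-Fredholm if $R(T)$ is closed and $\alpha(T)<\infty$, with index $\operatorname{ind}T=\alpha(T)-\beta(T)$; it is upper semi-Weyl if moreover $\operatorname{ind}T\le 0$. $\sigma_{uw}(T)$ is the set of $\lambda\in\mathbb{C}$ such that $T-\lambda I$ is not upper semi-Weyl. $\sigma_p^0(T)$ is the set of eigenvalues of $T$ of finite multiplicity ($0<\alpha(T-\lambda I)<\infty$), and $\pi_{00}^a(T)=\mathrm{iso}\,\sigma_a(T)\cap\sigma_p^0(T)$. $T$ satisfies property $(z)$ if $\sigma(T)\setminus\sigma_{uw}(T)=\pi_{00}^a(T)$. *)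

theory Defs
  imports "HOL-Analysis.Analysis"
begin

section \<open>Complex Banach spaces\<close>

text \<open>
  Complex scalars are added to the existing classes of real normed spaces, extending the given real
  scalar multiplication; norm, topology and completeness are the inherited ones.
\<close>

class complex_normed_vector = real_normed_vector +
  fixes scaleC :: "complex \<Rightarrow> 'a \<Rightarrow> 'a"  (infixr "*\<^sub>C" 75)
  assumes scaleC_add_right: "a *\<^sub>C (x + y) = a *\<^sub>C x + a *\<^sub>C y"
    and scaleC_add_left: "(a + b) *\<^sub>C x = a *\<^sub>C x + b *\<^sub>C x"
    and scaleC_scaleC: "a *\<^sub>C (b *\<^sub>C x) = (a * b) *\<^sub>C x"
    and scaleC_of_real: "complex_of_real r *\<^sub>C x = r *\<^sub>R x"
    and norm_scaleC: "norm (a *\<^sub>C x) = cmod a * norm x"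

class complex_banach = complex_normed_vector + complete_space

subclass (in complex_banach) banach ..

interpretation cvs: vector_space "scaleC :: complex \<Rightarrow> 'a \<Rightarrow> 'a::complex_normed_vector"
proof
  fix x :: 'a
  show "1 *\<^sub>C x = x"
    using scaleC_of_real[of 1 x] by simp
qed (simp_all add: scaleC_add_right scaleC_add_left scaleC_scaleC)

text \<open>
  The direct sum is the product type; its library norm is
  \<open>norm (x, y) = sqrt ((norm x)\<^sup>2 + (norm y)\<^sup>2)\<close>.  The direct sum of operators \<open>S\<close> and \<open>T\<close> is
  \<open>map_prod S T\<close>.
\<close>

instantiation prod :: (complex_normed_vector, complex_normed_vector) complex_normed_vector
begin

definition scaleC_prod :: "complex \<Rightarrow> 'a \<times> 'b \<Rightarrow> 'a \<times> 'b" where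
  "scaleC_prod a p = (a *\<^sub>C fst p, a *\<^sub>C snd p)"

instance
proof
  fix a b :: complex and r :: real and p q :: "'a \<times> 'b"
  show "a *\<^sub>C (p + q) = a *\<^sub>C p + a *\<^sub>C q" "(a + b) *\<^sub>C p = a *\<^sub>C p + b *\<^sub>C p"
    "a *\<^sub>C (b *\<^sub>C p) = (a * b) *\<^sub>C p"
    by (simp_all add: scaleC_prod_def scaleC_add_right scaleC_add_left scaleC_scaleC)
  show "complex_of_real r *\<^sub>C p = r *\<^sub>R p"
    by (simp add: scaleC_prod_def scaleC_of_real scaleR_prod_def)
  show "norm (a *\<^sub>C p) = cmod a * norm p"
    by (simp add: scaleC_prod_def norm_prod_def norm_scaleC power_mult_distrib
        real_sqrt_mult flip: distrib_left)
qed

end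

instance prod :: (complex_banach, complex_banach) complex_banach ..

definition bounded_clinear :: "('a::complex_normed_vector \<Rightarrow> 'b::complex_normed_vector) \<Rightarrow> bool" where
  "bounded_clinear T \<longleftrightarrow> Vector_Spaces.linear scaleC scaleC T \<and> (\<exists>K. \<forall>x. norm (T x) \<le> K * norm x)"


section \<open>Dimension and codimension\<close>

text \<open>Complex dimension; \<^const>\<open>cvs.dim\<close> alone does not separate dimension zero from infinite dimension.\<close>

definition cdim :: "'a::complex_normed_vector set \<Rightarrow> enat" where
  "cdim V = (if \<exists>B. finite B \<and> V \<subseteq> cvs.span B then enat (cvs.dim V) else \<infinity>)"

definition complementary :: "'a::complex_normed_vector set \<Rightarrow> 'a set \<Rightarrow> bool" where
  "complementary M W \<longleftrightarrow>
     cvs.subspace M \<and> cvs.subspace W \<and> M \<inter> W = {0} \<and> {m + w |m w. m \<in> M \<and> w \<in> W} = UNIV"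

text \<open>
  The codimension of a subspace is the dimension of an algebraic (not necessarily closed)
  complement.  All complements are isomorphic to the quotient space; \<open>ccodim_eq\<close> and
  \<open>complementary_exists\<close> below confirm that the choice is immaterial and always possible.
\<close>

definition ccodim :: "'a::complex_normed_vector set \<Rightarrow> enat" where
  "ccodim M = cdim (SOME W. complementary M W)"

lemma complementary_exists:
  assumes "cvs.subspace M"
  shows "\<exists>W. complementary M W"
proof -
  obtain B where B: "B \<subseteq> M" "cvs.independent B" "M \<subseteq> cvs.span B"
    by (rule cvs.maximal_independent_subset)
  obtain C where C: "B \<subseteq> C" "cvs.independent C" "UNIV \<subseteq> cvs.span C"
    by (rule cvs.maximal_independent_subset_extend[OF subset_UNIV B(2)])
  have M: "M = cvs.span B"
    by (rule subset_antisym[OF B(3) cvs.span_minimal[OF B(1) assms]])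
  have "x = 0" if x: "x \<in> cvs.span B" "x \<in> cvs.span (C - B)" for x
  proof -
    let ?r = "cvs.representation C x"
    have "?r = cvs.representation B x" "?r = cvs.representation (C - B) x"
      by (rule cvs.representation_extend[OF C(2) x(1) C(1)])
         (rule cvs.representation_extend[OF C(2) x(2) Diff_subset])
    then have "{v. ?r v \<noteq> 0} = {}"
      using cvs.representation_ne_zero[of B x] cvs.representation_ne_zero[of "C - B" x] by fastforce
    moreover have "(\<Sum>v | ?r v \<noteq> 0. ?r v *\<^sub>C v) = x"
      using cvs.sum_nonzero_representation_eq[OF C(2)] C(3) by blast
    ultimately show "x = 0"
      by simp
  qed
  then have "cvs.span B \<inter> cvs.span (C - B) = {0}"
    using cvs.span_zero by blast
  moreover have "{m + w |m w. m \<in> cvs.span B \<and> w \<in> cvs.span (C - B)} = UNIV"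
  proof -
    have "B \<union> (C - B) = C"
      using C(1) by blast
    then show ?thesis
      using cvs.span_Un[of B "C - B"] C(3) by (simp add: top.extremum_unique)
  qed
  ultimately have "complementary M (cvs.span (C - B))"
    unfolding complementary_def by (simp add: M cvs.subspace_span)
  then show ?thesis ..
qed

lemma cdim_complementary_le:
  assumes W: "complementary M W" and W': "complementary M W'"
  shows "cdim W' \<le> cdim W"
proof (cases "\<exists>B. finite B \<and> W \<subseteq> cvs.span B")
  case False
  then have "cdim W = \<infinity>"
    unfolding cdim_def by (rule if_not_P)
  then show ?thesis by simp
next
  case True
  have sub: "cvs.subspace M" "cvs.subspace W" "cvs.subspace W'"
    using W W' by (auto simp: complementary_def)
  obtain B where B: "B \<subseteq> W" "cvs.independent B" "W \<subseteq> cvs.span B" "card B = cvs.dim W"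
    using cvs.basis_exists by blast
  have finB: "finite B"
    using True B(1,2) cvs.independent_span_bound by (meson subset_trans)
  have "\<exists>w. w \<in> W' \<and> x - w \<in> M" for x
  proof -
    obtain m w where "x = m + w" "m \<in> M" "w \<in> W'"
      using W' unfolding complementary_def by blast
    then show ?thesis by (intro exI[of _ w]) simp
  qed
  then obtain P where P: "\<And>x. P x \<in> W'" "\<And>x. x - P x \<in> M"
    by metis
  have W'_span: "y \<in> cvs.span (P ` B)" if y: "y \<in> W'" for y
  proof -
    obtain m w where mw: "y = m + w" "m \<in> M" "w \<in> W"
      using W unfolding complementary_def by blast
    then obtain u where u: "w = (\<Sum>b\<in>B. u b *\<^sub>C b)"
      using B(3) cvs.span_finite[OF finB] by blast
    let ?v = "\<Sum>b\<in>B. u b *\<^sub>C P b"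
    have "w - ?v = (\<Sum>b\<in>B. u b *\<^sub>C (b - P b))"
      by (simp add: u sum_subtractf cvs.scale_right_diff_distrib)
    also have "\<dots> \<in> M"
      by (intro cvs.subspace_sum[OF sub(1)] cvs.subspace_scale[OF sub(1)] P)
    finally have "m + (w - ?v) \<in> M"
      using mw(2) cvs.subspace_add[OF sub(1)] by blast
    then have "y - ?v \<in> M"
      by (simp add: mw(1) algebra_simps)
    moreover have "y - ?v \<in> W'"
      by (intro cvs.subspace_diff[OF sub(3)] y cvs.subspace_sum[OF sub(3)]
          cvs.subspace_scale[OF sub(3)] P)
    ultimately have "y - ?v = 0"
      using W' unfolding complementary_def by blast
    then have "y = ?v"
      by simp
    moreover have "?v \<in> cvs.span (P ` B)"
      by (intro cvs.span_sum cvs.span_scale cvs.span_base imageI)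
    ultimately show ?thesis
      by simp
  qed
  have "cvs.dim W' \<le> card (P ` B)"
    by (rule cvs.dim_le_card) (use W'_span finB in auto)
  also have "\<dots> \<le> cvs.dim W"
    using card_image_le[OF finB, of P] B(4) by simp
  finally show ?thesis
    using True W'_span finB unfolding cdim_def
    by (auto intro!: exI[of _ "P ` B"])
qed

lemma ccodim_eq:
  assumes "complementary M W"
  shows "ccodim M = cdim W"
proof -
  have "complementary M (SOME W. complementary M W)"
    using assms by (rule someI)
  with assms show ?thesis
    unfolding ccodim_def by (intro order_antisym cdim_complementary_le)
qed


section \<open>Spectra and property (z)\<close>

definition shift :: "('a::complex_normed_vector \<Rightarrow> 'a) \<Rightarrow> complex \<Rightarrow> 'a \<Rightarrow> 'a" where
  "shift T z x = T x - z *\<^sub>C x"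

definition nullity :: "('a::complex_normed_vector \<Rightarrow> 'a) \<Rightarrow> enat" where
  "nullity T = cdim {x. T x = 0}"

definition deficiency :: "('a::complex_normed_vector \<Rightarrow> 'a) \<Rightarrow> enat" where
  "deficiency T = ccodim (range T)"

definition spectrum :: "('a::complex_normed_vector \<Rightarrow> 'a) \<Rightarrow> complex set" where
  "spectrum T = {z. \<not> (\<exists>R. bounded_clinear R \<and> R \<circ> shift T z = id \<and> shift T z \<circ> R = id)}"

definition approx_point_spectrum :: "('a::complex_normed_vector \<Rightarrow> 'a) \<Rightarrow> complex set" where
  "approx_point_spectrum T =
     {z. \<exists>x. (\<forall>n::nat. norm (x n) = 1) \<and> (\<lambda>n. shift T z (x n)) \<longlonglongrightarrow> 0}"

definition iso :: "complex set \<Rightarrow> complex set" where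
  "iso A = {z. z isolated_in A}"

definition upper_semi_Fredholm :: "('a::complex_normed_vector \<Rightarrow> 'a) \<Rightarrow> bool" where
  "upper_semi_Fredholm T \<longleftrightarrow> closed (range T) \<and> nullity T < \<infinity>"

text \<open>
  Used only for finite nullity, where it takes values in the integers extended by \<open>-\<infinity>\<close>.
\<close>

definition index :: "('a::complex_normed_vector \<Rightarrow> 'a) \<Rightarrow> ereal" where
  "index T = ereal_of_enat (nullity T) - ereal_of_enat (deficiency T)"

definition upper_semi_Weyl :: "('a::complex_normed_vector \<Rightarrow> 'a) \<Rightarrow> bool" where
  "upper_semi_Weyl T \<longleftrightarrow> upper_semi_Fredholm T \<and> index T \<le> 0"

definition sigma_uw :: "('a::complex_normed_vector \<Rightarrow> 'a) \<Rightarrow> complex set" where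
  "sigma_uw T = {z. \<not> upper_semi_Weyl (shift T z)}"

definition sigma_p0 :: "('a::complex_normed_vector \<Rightarrow> 'a) \<Rightarrow> complex set" where
  "sigma_p0 T = {z. 0 < nullity (shift T z) \<and> nullity (shift T z) < \<infinity>}"

definition pi00_a :: "('a::complex_normed_vector \<Rightarrow> 'a) \<Rightarrow> complex set" where
  "pi00_a T = iso (approx_point_spectrum T) \<inter> sigma_p0 T"

definition property_z :: "('a::complex_normed_vector \<Rightarrow> 'a) \<Rightarrow> bool" where
  "property_z T \<longleftrightarrow> spectrum T - sigma_uw T = pi00_a T"

end

theory Submission
  imports Defs
begin

text \<open>
  Write \<open>\<sigma>\<close>, \<open>\<sigma>\<^sub>u\<^sub>w\<close>, \<open>\<pi>\<close> for \<^const>\<open>spectrum\<close>, \<^const>\<open>sigma_uw\<close>, \<^const>\<open>pi00_a\<close>.  The point is that, under the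
  hypotheses, the two sides of property (z) for \<open>S \<oplus> T\<close> differ from each other only by what
  \<open>\<sigma>\<^sub>u\<^sub>w(S \<oplus> T)\<close> lacks of \<open>\<sigma>\<^sub>u\<^sub>w(S) \<union> \<sigma>\<^sub>u\<^sub>w(T)\<close>.

  The spectrum and the approximate point spectrum of \<open>S \<oplus> T\<close> are the unions of those of the
  summands.  If \<open>\<sigma>\<^sub>p\<^sup>0(S) = \<sigma>\<^sub>p\<^sup>0(T)\<close>, this common set is also \<open>\<sigma>\<^sub>p\<^sup>0(S \<oplus> T)\<close>, because nullities add.
  Its points are eigenvalues of both operators, hence lie in both approximate point spectra, and a
  point common to two sets is isolated in their union exactly when it is isolated in each.
  Therefore \<open>\<pi>(S \<oplus> T) = \<pi>(S) \<inter> \<pi>(T)\<close> (\<open>pi00_a_map_prod\<close>).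

  On the other hand, property (z) of the summands gives
  \<open>(\<sigma>(S) \<union> \<sigma>(T)) - (\<sigma>\<^sub>u\<^sub>w(S) \<union> \<sigma>\<^sub>u\<^sub>w(T)) = \<pi>(S) \<inter> \<pi>(T)\<close>: a point on the left, in \<open>\<sigma>(S)\<close> say,
  lies in \<open>\<pi>(S)\<close>, so it is an eigenvalue of \<open>T\<close> as well, hence in \<open>\<sigma>(T) - \<sigma>\<^sub>u\<^sub>w(T) = \<pi>(T)\<close>.
  So property (z) for \<open>S \<oplus> T\<close> says that \<open>\<sigma>\<^sub>u\<^sub>w(S \<oplus> T)\<close> and \<open>\<sigma>\<^sub>u\<^sub>w(S) \<union> \<sigma>\<^sub>u\<^sub>w(T)\<close> have the same
  complement in \<open>\<sigma>(S \<oplus> T)\<close>.  Since both are subsets of \<open>\<sigma>(S \<oplus> T)\<close>, this means that they are equal.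
  The inclusion of the former in the latter (\<open>sigma_uw_map_prod_subset\<close>) holds because
  nullities and deficiencies add.
\<close>

section \<open>Dimension of products\<close>

lemma finite_cdim_basis:
  assumes "cvs.subspace V" "finite A" "V \<subseteq> cvs.span A"
  obtains B where "B \<subseteq> V" "finite B" "cvs.independent B" "V = cvs.span B" "cdim V = enat (card B)"
proof -
  obtain B where B: "B \<subseteq> V" "cvs.independent B" "V \<subseteq> cvs.span B" "card B = cvs.dim V"
    using cvs.basis_exists by blast
  have "finite B"
    using cvs.independent_span_bound[OF assms(2) B(2)] B(1) assms(3) by blast
  moreover have "V = cvs.span B"
    by (rule subset_antisym[OF B(3) cvs.span_minimal[OF B(1) assms(1)]])
  moreover have "cdim V = enat (card B)"
    using assms(2,3) B(4) unfolding cdim_def by auto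
  ultimately show ?thesis
    using that B(1,2) by blast
qed

lemma cdim_span_independent:
  assumes "finite B" "cvs.independent B"
  shows "cdim (cvs.span B) = enat (card B)"
  using assms cvs.dim_span_eq_card_independent[OF assms(2)] unfolding cdim_def by auto

lemma cdim_eq_0_iff:
  assumes "cvs.subspace V"
  shows "cdim V = 0 \<longleftrightarrow> V = {0}"
proof
  assume *: "cdim V = 0"
  then obtain A where "finite A" "V \<subseteq> cvs.span A"
    unfolding cdim_def by (auto split: if_splits)
  with assms obtain B where "finite B" "V = cvs.span B" "cdim V = enat (card B)"
    by (rule finite_cdim_basis)
  with * show "V = {0}"
    by (simp add: enat_0_iff)
next
  assume "V = {0}"
  then show "cdim V = 0"
    using cdim_span_independent[of "{} :: 'a set"] by (simp add: zero_enat_def cvs.independent_empty)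
qed

lemma linear_Pair_0: "Vector_Spaces.linear scaleC scaleC (\<lambda>x. (x, 0))"
  by unfold_locales (simp_all add: scaleC_prod_def)

lemma linear_0_Pair: "Vector_Spaces.linear scaleC scaleC (Pair 0)"
  by unfold_locales (simp_all add: scaleC_prod_def)

lemma linear_fst: "Vector_Spaces.linear scaleC scaleC fst"
  by unfold_locales (simp_all add: scaleC_prod_def)

lemma linear_snd: "Vector_Spaces.linear scaleC scaleC snd"
  by unfold_locales (simp_all add: scaleC_prod_def)

lemma linear_comp_scaleC:
  "Vector_Spaces.linear scaleC scaleC f \<Longrightarrow> Vector_Spaces.linear scaleC scaleC g \<Longrightarrow>
   Vector_Spaces.linear scaleC scaleC (\<lambda>x. g (f x))"
  using Vector_Spaces.linear_compose[of scaleC scaleC f scaleC g] by (simp add: o_def)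

lemma subspace_Times:
  "cvs.subspace A \<Longrightarrow> cvs.subspace B \<Longrightarrow> cvs.subspace (A \<times> B)"
  by (auto simp: cvs.subspace_def scaleC_prod_def zero_prod_def)

lemma span_Pair_image_Un:
  "cvs.span ((\<lambda>x. (x, 0)) ` A \<union> Pair 0 ` B) = cvs.span A \<times> cvs.span B"
proof -
  have "cvs.span ((\<lambda>x. (x, 0 :: 'b)) ` A) = (\<lambda>x. (x, 0)) ` cvs.span A"
    by (rule module_hom.span_image[OF linear_Pair_0[unfolded linear_iff_module_hom]])
  moreover have "cvs.span (Pair (0 :: 'a) ` B) = Pair 0 ` cvs.span B"
    by (rule module_hom.span_image[OF linear_0_Pair[unfolded linear_iff_module_hom]])
  ultimately have "cvs.span ((\<lambda>x. (x, 0)) ` A \<union> Pair 0 ` B) =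
      {p + q |p q. p \<in> (\<lambda>x. (x, 0)) ` cvs.span A \<and> q \<in> Pair 0 ` cvs.span B}"
    by (simp only: cvs.span_Un)
  also have "\<dots> = cvs.span A \<times> cvs.span B"
  proof (intro set_eqI iffI)
    fix r :: "'a \<times> 'b"
    assume "r \<in> cvs.span A \<times> cvs.span B"
    then obtain x y where "r = (x, 0) + (0, y)" "x \<in> cvs.span A" "y \<in> cvs.span B"
      by auto
    then show "r \<in> {p + q |p q. p \<in> (\<lambda>x. (x, 0)) ` cvs.span A \<and> q \<in> Pair 0 ` cvs.span B}"
      by blast
  qed auto
  finally show ?thesis .
qed

lemma independent_Pair_image_Un:
  assumes "finite A" "finite B" "cvs.independent A" "cvs.independent B"
  shows "cvs.independent ((\<lambda>x. (x, 0)) ` A \<union> Pair 0 ` B)"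
proof (rule cvs.independent_if_scalars_zero)
  have disjoint: "(\<lambda>x. (x, 0)) ` A \<inter> Pair 0 ` B = {}"
    using assms(3) cvs.dependent_zero by auto
  fix u p
  assume sum: "(\<Sum>p\<in>(\<lambda>x. (x, 0)) ` A \<union> Pair 0 ` B. u p *\<^sub>C p) = 0"
    and p: "p \<in> (\<lambda>x. (x, 0)) ` A \<union> Pair 0 ` B"
  have "(\<Sum>p\<in>(\<lambda>x. (x, 0)) ` A \<union> Pair 0 ` B. u p *\<^sub>C p) =
        (\<Sum>x\<in>A. u (x, 0) *\<^sub>C (x, 0)) + (\<Sum>y\<in>B. u (0, y) *\<^sub>C (0, y))"
    using assms(1,2) disjoint by (simp add: sum.union_disjoint sum.reindex inj_on_def)
  also have "\<dots> = ((\<Sum>x\<in>A. u (x, 0) *\<^sub>C x), (\<Sum>y\<in>B. u (0, y) *\<^sub>C y))"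
    by (simp add: prod_eq_iff fst_sum snd_sum scaleC_prod_def)
  finally have "(\<Sum>x\<in>A. u (x, 0) *\<^sub>C x) = 0" "(\<Sum>y\<in>B. u (0, y) *\<^sub>C y) = 0"
    using sum by (simp_all add: zero_prod_def)
  then have "\<forall>x\<in>A. u (x, 0) = 0" "\<forall>y\<in>B. u (0, y) = 0"
    using cvs.independentD[OF assms(3,1) order_refl, of "\<lambda>x. u (x, 0)"]
      cvs.independentD[OF assms(4,2) order_refl, of "\<lambda>y. u (0, y)"] by auto
  with p show "u p = 0"
    by auto
qed (use assms in auto)

lemma cdim_Times:
  assumes "cvs.subspace A" "cvs.subspace B"
  shows "cdim (A \<times> B) = cdim A + cdim B"
proof (cases "(\<exists>F. finite F \<and> A \<subseteq> cvs.span F) \<and> (\<exists>F. finite F \<and> B \<subseteq> cvs.span F)")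
  case True
  obtain C where C: "finite C" "cvs.independent C" "A = cvs.span C" "cdim A = enat (card C)"
    using True finite_cdim_basis[OF assms(1)] by metis
  obtain D where D: "finite D" "cvs.independent D" "B = cvs.span D" "cdim B = enat (card D)"
    using True finite_cdim_basis[OF assms(2)] by metis
  let ?E = "(\<lambda>x. (x, 0)) ` C \<union> Pair 0 ` D"
  have "cdim (A \<times> B) = enat (card ?E)"
    using cdim_span_independent[of ?E] independent_Pair_image_Un[OF C(1) D(1) C(2) D(2)] C D
    by (simp add: span_Pair_image_Un)
  also have "card ?E = card C + card D"
    using C(1,2) D(1) cvs.dependent_zero[of C]
    by (subst card_Un_disjoint) (auto simp: card_image inj_on_def)
  finally show ?thesis
    using C D by simp
next
  case False
  \<comment> \<open>A finite spanning set of the product would project onto finite spanning sets of both factors.\<close>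
  have "\<nexists>F. finite F \<and> A \<times> B \<subseteq> cvs.span F"
  proof
    assume "\<exists>F. finite F \<and> A \<times> B \<subseteq> cvs.span F"
    then obtain F where F: "finite F" "A \<times> B \<subseteq> cvs.span F" by blast
    have "fst ` (A \<times> B) \<subseteq> cvs.span (fst ` F)" "snd ` (A \<times> B) \<subseteq> cvs.span (snd ` F)"
      using module_hom.spans_image[OF linear_fst[unfolded linear_iff_module_hom] F(2)]
        module_hom.spans_image[OF linear_snd[unfolded linear_iff_module_hom] F(2)] .
    moreover have "fst ` (A \<times> B) = A" "snd ` (A \<times> B) = B"
      using cvs.subspace_0[OF assms(1)] cvs.subspace_0[OF assms(2)]
      by (auto simp: fst_image_times snd_image_times)
    ultimately show False
      using False F(1) finite_imageI by auto
  qed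
  then have "cdim (A \<times> B) = \<infinity>"
    unfolding cdim_def by (rule if_not_P)
  moreover have "cdim A = \<infinity> \<or> cdim B = \<infinity>"
    using False unfolding cdim_def by (auto split: if_splits)
  ultimately show ?thesis
    by auto
qed

lemma complementary_Times:
  assumes MW: "complementary M W" and NZ: "complementary N Z"
  shows "complementary (M \<times> N) (W \<times> Z)"
  unfolding complementary_def
proof (intro conjI subspace_Times)
  show "cvs.subspace M" "cvs.subspace N" "cvs.subspace W" "cvs.subspace Z"
    using MW NZ by (simp_all add: complementary_def)
  show "(M \<times> N) \<inter> (W \<times> Z) = {0}"
    using MW NZ by (simp add: complementary_def Times_Int_Times zero_prod_def)
  show "{m + w |m w. m \<in> M \<times> N \<and> w \<in> W \<times> Z} = UNIV"
  proof (intro set_eqI iffI UNIV_I)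
    fix p :: "'a \<times> 'b"
    have "fst p \<in> {m + w |m w. m \<in> M \<and> w \<in> W}" "snd p \<in> {n + z |n z. n \<in> N \<and> z \<in> Z}"
      using MW NZ by (simp_all add: complementary_def)
    then obtain m w n z where "fst p = m + w" "m \<in> M" "w \<in> W" "snd p = n + z" "n \<in> N" "z \<in> Z"
      by auto
    then have "p = (m, n) + (w, z)" "(m, n) \<in> M \<times> N" "(w, z) \<in> W \<times> Z"
      by (simp_all add: prod_eq_iff)
    then show "p \<in> {m + w |m w. m \<in> M \<times> N \<and> w \<in> W \<times> Z}"
      by blast
  qed
qed

lemma ccodim_Times:
  assumes "cvs.subspace M" "cvs.subspace N"
  shows "ccodim (M \<times> N) = ccodim M + ccodim N"
proof -
  obtain W Z where WZ: "complementary M W" "complementary N Z"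
    using complementary_exists assms by metis
  then have "cvs.subspace W" "cvs.subspace Z"
    by (auto simp: complementary_def)
  with WZ show ?thesis
    by (simp add: ccodim_eq ccodim_eq[OF complementary_Times[OF WZ]] cdim_Times)
qed

section \<open>Direct sums of linear maps\<close>

lemma linear_shift:
  assumes "Vector_Spaces.linear scaleC scaleC T"
  shows "Vector_Spaces.linear scaleC scaleC (shift T z)"
proof -
  interpret T: Vector_Spaces.linear scaleC scaleC T by (rule assms)
  show ?thesis
    by unfold_locales (simp_all add: shift_def T.add T.scale cvs.scale_right_distrib
        cvs.scale_right_diff_distrib cvs.scale_left_commute)
qed

lemma linear_scaleC_0: "Vector_Spaces.linear scaleC scaleC f \<Longrightarrow> f 0 = 0"
  unfolding linear_iff_module_hom by (rule module_hom.zero)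

lemma linear_map_prod:
  assumes "Vector_Spaces.linear scaleC scaleC f" "Vector_Spaces.linear scaleC scaleC g"
  shows "Vector_Spaces.linear scaleC scaleC (map_prod f g)"
proof -
  interpret f: Vector_Spaces.linear scaleC scaleC f by (rule assms(1))
  interpret g: Vector_Spaces.linear scaleC scaleC g by (rule assms(2))
  show ?thesis
    by unfold_locales
      (simp_all add: map_prod_def case_prod_beta scaleC_prod_def f.add f.scale g.add g.scale)
qed

lemma shift_map_prod: "shift (map_prod S T) z = map_prod (shift S z) (shift T z)"
  by (auto simp: shift_def fun_eq_iff scaleC_prod_def)

lemma subspace_kernel:
  "Vector_Spaces.linear scaleC scaleC f \<Longrightarrow> cvs.subspace {x. f x = 0}"
  unfolding linear_iff_module_hom by (rule module_hom.subspace_kernel)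

lemma subspace_range:
  "Vector_Spaces.linear scaleC scaleC f \<Longrightarrow> cvs.subspace (range f)"
  unfolding linear_iff_module_hom by (rule module_hom.subspace_image) (auto simp: cvs.subspace_UNIV)

lemma nullity_map_prod:
  assumes "Vector_Spaces.linear scaleC scaleC f" "Vector_Spaces.linear scaleC scaleC g"
  shows "nullity (map_prod f g) = nullity f + nullity g"
proof -
  have "{p. map_prod f g p = 0} = {x. f x = 0} \<times> {y. g y = 0}"
    by (auto simp: zero_prod_def)
  then show ?thesis
    using assms by (simp add: nullity_def cdim_Times subspace_kernel)
qed

lemma range_map_prod: "range (map_prod f g) = range f \<times> range g"
  by (metis UNIV_Times_UNIV map_prod_surj_on)

lemma deficiency_map_prod:
  assumes "Vector_Spaces.linear scaleC scaleC f" "Vector_Spaces.linear scaleC scaleC g"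
  shows "deficiency (map_prod f g) = deficiency f + deficiency g"
  using assms by (simp add: deficiency_def range_map_prod ccodim_Times subspace_range)

lemma nullity_eq_0_iff:
  assumes "Vector_Spaces.linear scaleC scaleC f"
  shows "nullity f = 0 \<longleftrightarrow> (\<forall>x. f x = 0 \<longrightarrow> x = 0)"
  using cdim_eq_0_iff[OF subspace_kernel[OF assms]] cvs.subspace_0[OF subspace_kernel[OF assms]]
  by (auto simp: nullity_def)

section \<open>Spectral sets of a direct sum\<close>

lemma bounded_clinear_map_prod:
  assumes "bounded_clinear f" "bounded_clinear g"
  shows "bounded_clinear (map_prod f g)"
proof -
  obtain K L where K: "\<And>x. norm (f x) \<le> K * norm x" and L: "\<And>y. norm (g y) \<le> L * norm y"
    using assms unfolding bounded_clinear_def by blast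
  have "norm (map_prod f g p) \<le> (\<bar>K\<bar> + \<bar>L\<bar>) * norm p" for p
  proof -
    have "norm (map_prod f g p) \<le> norm (f (fst p)) + norm (g (snd p))"
      using norm_Pair_le[of "f (fst p)" "g (snd p)"] by (simp add: map_prod_def case_prod_beta)
    also have "\<dots> \<le> K * norm (fst p) + L * norm (snd p)"
      by (intro add_mono K L)
    also have "\<dots> \<le> \<bar>K\<bar> * norm p + \<bar>L\<bar> * norm p"
      using norm_fst_le[of "fst p" "snd p"] norm_snd_le[of "snd p" "fst p"]
      by (intro add_mono mult_mono) simp_all
    finally show ?thesis
      by (simp add: distrib_right)
  qed
  moreover have "Vector_Spaces.linear scaleC scaleC (map_prod f g)"
    using assms by (intro linear_map_prod) (simp_all add: bounded_clinear_def)
  ultimately show ?thesis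
    unfolding bounded_clinear_def by blast
qed

text \<open>
  Seen as a block matrix, a bounded inverse of a direct sum has bounded inverses of the summands as
  its diagonal entries.
\<close>

lemma spectrum_map_prod:
  assumes S: "Vector_Spaces.linear scaleC scaleC S" and T: "Vector_Spaces.linear scaleC scaleC T"
  shows "spectrum (map_prod S T) = spectrum S \<union> spectrum T"
proof -
  have "z \<notin> spectrum (map_prod S T) \<longleftrightarrow> z \<notin> spectrum S \<and> z \<notin> spectrum T" for z
  proof
    let ?f = "shift S z" and ?g = "shift T z"
    have f0: "?f 0 = 0" and g0: "?g 0 = 0"
      by (intro linear_scaleC_0 linear_shift S T)+
    assume "z \<notin> spectrum (map_prod S T)"
    then obtain R where R: "bounded_clinear R"
      and left: "\<And>x y. R (?f x, ?g y) = (x, y)" and right: "\<And>p. map_prod ?f ?g (R p) = p"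
      by (auto simp: spectrum_def shift_map_prod fun_eq_iff)
    obtain K where K: "\<And>p. norm (R p) \<le> K * norm p"
      using R unfolding bounded_clinear_def by blast
    have linR: "Vector_Spaces.linear scaleC scaleC R"
      using R by (simp add: bounded_clinear_def)
    have "norm (fst (R (x, 0))) \<le> K * norm x" for x
      using K[of "(x, 0)"] norm_fst_le[of "fst (R (x, 0))" "snd (R (x, 0))"] by simp
    then have "bounded_clinear (\<lambda>x. fst (R (x, 0)))"
      unfolding bounded_clinear_def
      using linear_comp_scaleC[OF linear_comp_scaleC[OF linear_Pair_0 linR] linear_fst] by blast
    moreover have "fst (R (?f x, 0)) = x" for x
      using left[of x 0] by (simp add: g0)
    moreover have "?f (fst (R (x, 0))) = x" for x
      using right[of "(x, 0)"] by (metis fst_conv fst_map_prod)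
    moreover have "norm (snd (R (0, y))) \<le> K * norm y" for y
      using K[of "(0, y)"] norm_snd_le[of "snd (R (0, y))" "fst (R (0, y))"] by simp
    then have "bounded_clinear (\<lambda>y. snd (R (0, y)))"
      unfolding bounded_clinear_def
      using linear_comp_scaleC[OF linear_comp_scaleC[OF linear_0_Pair linR] linear_snd] by blast
    moreover have "snd (R (0, ?g y)) = y" for y
      using left[of 0 y] by (simp add: f0)
    moreover have "?g (snd (R (0, y))) = y" for y
      using right[of "(0, y)"] by (metis snd_conv snd_map_prod)
    ultimately show "z \<notin> spectrum S \<and> z \<notin> spectrum T"
      unfolding spectrum_def
      by (auto simp: fun_eq_iff intro: exI[of _ "\<lambda>x. fst (R (x, 0))"]
          exI[of _ "\<lambda>y. snd (R (0, y))"])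
  next
    assume "z \<notin> spectrum S \<and> z \<notin> spectrum T"
    then obtain P Q where
      "bounded_clinear P" "P \<circ> shift S z = id" "shift S z \<circ> P = id"
      "bounded_clinear Q" "Q \<circ> shift T z = id" "shift T z \<circ> Q = id"
      by (auto simp: spectrum_def)
    then show "z \<notin> spectrum (map_prod S T)"
      unfolding spectrum_def
      by (auto simp: shift_map_prod map_prod_compose[symmetric] map_prod.id
          intro!: exI[of _ "map_prod P Q"] bounded_clinear_map_prod)
  qed
  then show ?thesis
    by blast
qed

text \<open>
  Being bounded below, unlike the existence of unit vectors with images tending to zero, can be
  read off from the components of a direct sum.
\<close>

lemma approx_point_spectrum_iff_not_bounded_below:
  assumes "Vector_Spaces.linear scaleC scaleC T"
  shows "z \<in> approx_point_spectrum T \<longleftrightarrow> \<not> (\<exists>c>0. \<forall>x. c * norm x \<le> norm (shift T z x))"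
proof
  assume "z \<in> approx_point_spectrum T"
  then obtain x where x: "\<And>n::nat. norm (x n) = 1" "(\<lambda>n. shift T z (x n)) \<longlonglongrightarrow> 0"
    by (auto simp: approx_point_spectrum_def)
  show "\<not> (\<exists>c>0. \<forall>x. c * norm x \<le> norm (shift T z x))"
  proof
    assume "\<exists>c>0. \<forall>x. c * norm x \<le> norm (shift T z x)"
    then obtain c where c: "c > 0" "\<And>x. c * norm x \<le> norm (shift T z x)" by blast
    have "c \<le> norm (shift T z (x n))" for n
      using c(2)[of "x n"] x(1) by simp
    moreover have "(\<lambda>n. norm (shift T z (x n))) \<longlonglongrightarrow> 0"
      using x(2) by (rule tendsto_norm_zero)
    ultimately have "c \<le> 0"
      by (intro LIMSEQ_le_const) auto
    with c(1) show False by simp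
  qed
next
  interpret f: Vector_Spaces.linear scaleC scaleC "shift T z"
    by (rule linear_shift[OF assms])
  assume "\<not> (\<exists>c>0. \<forall>x. c * norm x \<le> norm (shift T z x))"
  then have "\<exists>x. norm (shift T z x) < inverse (real (Suc n)) * norm x" for n
    by (meson not_le inverse_positive_iff_positive of_nat_0_less_iff zero_less_Suc)
  then obtain x where x: "\<And>n. norm (shift T z (x n)) < inverse (real (Suc n)) * norm (x n)"
    by metis
  have pos: "norm (x n) > 0" for n
    using x[of n] by (auto simp: f.zero)
  define y where "y n = complex_of_real (inverse (norm (x n))) *\<^sub>C x n" for n
  have "norm (shift T z (y n)) = norm (shift T z (x n)) / norm (x n)" for n
    by (simp add: y_def f.scale norm_scaleC norm_inverse divide_inverse mult.commute)
  then have "norm (shift T z (y n)) \<le> inverse (real (Suc n))" for n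
    using x[of n] pos[of n] by (simp add: pos_divide_le_eq less_imp_le)
  then have "(\<lambda>n. shift T z (y n)) \<longlonglongrightarrow> 0"
    by (intro Lim_null_comparison[OF _ LIMSEQ_inverse_real_of_nat]) auto
  moreover have "norm (y n) = 1" for n
    using pos[of n] by (simp add: y_def norm_scaleC norm_inverse)
  ultimately show "z \<in> approx_point_spectrum T"
    unfolding approx_point_spectrum_def by blast
qed

lemma bounded_below_map_prod_iff:
  fixes f :: "'a::real_normed_vector \<Rightarrow> 'c::real_normed_vector"
    and g :: "'b::real_normed_vector \<Rightarrow> 'd::real_normed_vector"
  assumes "f 0 = 0" "g 0 = 0"
  shows "(\<exists>c>0. \<forall>p. c * norm p \<le> norm (map_prod f g p)) \<longleftrightarrow>
    (\<exists>c>0. \<forall>x. c * norm x \<le> norm (f x)) \<and> (\<exists>c>0. \<forall>y. c * norm y \<le> norm (g y))"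
proof
  assume "\<exists>c>0. \<forall>p. c * norm p \<le> norm (map_prod f g p)"
  then obtain c where c: "c > 0" "\<And>p. c * norm p \<le> norm (map_prod f g p)" by blast
  have "c * norm x \<le> norm (f x)" "c * norm y \<le> norm (g y)" for x y
    using c(2)[of "(x, 0)"] c(2)[of "(0, y)"] assms by simp_all
  with c(1) show "(\<exists>c>0. \<forall>x. c * norm x \<le> norm (f x)) \<and> (\<exists>c>0. \<forall>y. c * norm y \<le> norm (g y))"
    by blast
next
  assume "(\<exists>c>0. \<forall>x. c * norm x \<le> norm (f x)) \<and> (\<exists>c>0. \<forall>y. c * norm y \<le> norm (g y))"
  then obtain a b where a: "a > 0" "\<And>x. a * norm x \<le> norm (f x)"
    and b: "b > 0" "\<And>y. b * norm y \<le> norm (g y)" by blast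
  define c where "c = min a b"
  have "c > 0" using a b by (simp add: c_def)
  moreover have "c * norm p \<le> norm (map_prod f g p)" for p
  proof -
    have "c * norm x \<le> norm (f x)" "c * norm y \<le> norm (g y)" for x y
      using a(2)[of x] b(2)[of y] mult_right_mono[of c a "norm x"] mult_right_mono[of c b "norm y"]
      by (auto simp: c_def)
    then have "sqrt ((c * norm (fst p))\<^sup>2 + (c * norm (snd p))\<^sup>2) \<le>
        sqrt ((norm (f (fst p)))\<^sup>2 + (norm (g (snd p)))\<^sup>2)"
      using \<open>c > 0\<close> by (intro real_sqrt_le_mono add_mono power_mono) auto
    moreover have "sqrt ((c * norm (fst p))\<^sup>2 + (c * norm (snd p))\<^sup>2) = c * norm p"
      using \<open>c > 0\<close>
      by (simp add: norm_prod_def power_mult_distrib real_sqrt_mult flip: distrib_left)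
    ultimately show ?thesis
      by (simp only: norm_prod_def fst_map_prod snd_map_prod)
  qed
  ultimately show "\<exists>c>0. \<forall>p. c * norm p \<le> norm (map_prod f g p)"
    by blast
qed

lemma approx_point_spectrum_map_prod:
  assumes S: "Vector_Spaces.linear scaleC scaleC S" and T: "Vector_Spaces.linear scaleC scaleC T"
  shows "approx_point_spectrum (map_prod S T) = approx_point_spectrum S \<union> approx_point_spectrum T"
proof -
  have "z \<in> approx_point_spectrum (map_prod S T) \<longleftrightarrow>
      z \<in> approx_point_spectrum S \<or> z \<in> approx_point_spectrum T" for z
  proof -
    have "shift S z 0 = 0" "shift T z 0 = 0"
      by (intro linear_scaleC_0 linear_shift S T)+
    from bounded_below_map_prod_iff[where f = "shift S z" and g = "shift T z", OF this] show ?thesis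
      unfolding approx_point_spectrum_iff_not_bounded_below[OF S]
        approx_point_spectrum_iff_not_bounded_below[OF T]
        approx_point_spectrum_iff_not_bounded_below[OF linear_map_prod[OF S T]] shift_map_prod
      by blast
  qed
  then show ?thesis
    by blast
qed

lemma eigenvalue_in_approx_point_spectrum:
  assumes "Vector_Spaces.linear scaleC scaleC T" "nullity (shift T z) \<noteq> 0"
  shows "z \<in> approx_point_spectrum T"
proof -
  obtain x where "shift T z x = 0" "x \<noteq> 0"
    using assms by (auto simp: nullity_eq_0_iff linear_shift)
  then show ?thesis
    by (auto simp: approx_point_spectrum_iff_not_bounded_below assms not_le intro!: exI[of _ x])
qed

lemma nullity_shift_eq_0_if_not_spectrum:
  assumes "Vector_Spaces.linear scaleC scaleC T" "z \<notin> spectrum T"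
  shows "nullity (shift T z) = 0"
proof -
  obtain R where "R \<circ> shift T z = id"
    using assms(2) by (auto simp: spectrum_def)
  then have "inj (shift T z)"
    by (metis inj_on_id inj_on_imageI2)
  moreover have "shift T z 0 = 0"
    by (intro linear_scaleC_0 linear_shift assms(1))
  ultimately show ?thesis
    using assms(1) by (auto simp: nullity_eq_0_iff linear_shift dest: injD[of _ _ 0])
qed

lemma sigma_p0_subset_spectrum:
  "Vector_Spaces.linear scaleC scaleC T \<Longrightarrow> sigma_p0 T \<subseteq> spectrum T"
  using nullity_shift_eq_0_if_not_spectrum by (fastforce simp: sigma_p0_def)

lemma upper_semi_Weyl_iff:
  "upper_semi_Weyl T \<longleftrightarrow> closed (range T) \<and> nullity T < \<infinity> \<and> nullity T \<le> deficiency T"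
  unfolding upper_semi_Weyl_def upper_semi_Fredholm_def index_def
  by (cases "nullity T"; cases "deficiency T") auto

lemma sigma_uw_subset_spectrum:
  assumes "Vector_Spaces.linear scaleC scaleC T"
  shows "sigma_uw T \<subseteq> spectrum T"
proof
  fix z
  assume z: "z \<in> sigma_uw T"
  show "z \<in> spectrum T"
  proof (rule ccontr)
    assume not_spectrum: "z \<notin> spectrum T"
    then obtain R where "shift T z \<circ> R = id"
      by (auto simp: spectrum_def)
    then have "range (shift T z) = UNIV"
      by (metis surjI o_apply id_apply)
    then have "upper_semi_Weyl (shift T z)"
      using nullity_shift_eq_0_if_not_spectrum[OF assms not_spectrum]
      by (simp add: upper_semi_Weyl_iff)
    with z show False
      by (simp add: sigma_uw_def)
  qed
qed

lemma upper_semi_Weyl_map_prod: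
  assumes "Vector_Spaces.linear scaleC scaleC f" "Vector_Spaces.linear scaleC scaleC g"
    and "upper_semi_Weyl f" "upper_semi_Weyl g"
  shows "upper_semi_Weyl (map_prod f g)"
  using assms
  by (auto simp: upper_semi_Weyl_iff range_map_prod nullity_map_prod deficiency_map_prod
      closed_Times intro: add_mono)

text \<open>
  The inclusion can be strict: a positive index of one summand can be compensated by a negative
  index of the other.
\<close>

lemma sigma_uw_map_prod_subset:
  assumes "Vector_Spaces.linear scaleC scaleC S" "Vector_Spaces.linear scaleC scaleC T"
  shows "sigma_uw (map_prod S T) \<subseteq> sigma_uw S \<union> sigma_uw T"
  using assms by (auto simp: sigma_uw_def shift_map_prod linear_shift upper_semi_Weyl_map_prod)

section \<open>Property (z) for direct sums\<close>

lemma isolated_in_Un_iff: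
  assumes "x \<in> A" "x \<in> B"
  shows "x isolated_in (A \<union> B) \<longleftrightarrow> x isolated_in A \<and> x isolated_in B"
  using assms by (auto simp: isolated_in_islimpt_iff islimpt_Un)

text \<open>
  A sum of two nullities is positive and finite when both are finite and one is positive; the
  positive one then places the point in the common set.  If the two sets differed, an eigenvalue of
  finite multiplicity of \<open>T\<close> alone could belong to \<open>\<sigma>\<^sub>p\<^sup>0(S \<oplus> T)\<close> without being in the spectrum of \<open>S\<close>.
\<close>

lemma sigma_p0_map_prod:
  assumes "Vector_Spaces.linear scaleC scaleC S" "Vector_Spaces.linear scaleC scaleC T"
    and "sigma_p0 S = sigma_p0 T"
  shows "sigma_p0 (map_prod S T) = sigma_p0 S"
proof (rule set_eqI)
  fix z
  have "z \<in> sigma_p0 S \<longleftrightarrow> z \<in> sigma_p0 T"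
    using assms(3) by simp
  then show "z \<in> sigma_p0 (map_prod S T) \<longleftrightarrow> z \<in> sigma_p0 S"
    by (cases "nullity (shift S z)"; cases "nullity (shift T z)")
      (auto simp: sigma_p0_def shift_map_prod nullity_map_prod linear_shift assms(1,2)
        zero_enat_def)
qed

lemma pi00_a_map_prod:
  assumes S: "Vector_Spaces.linear scaleC scaleC S" and T: "Vector_Spaces.linear scaleC scaleC T"
    and eq: "sigma_p0 S = sigma_p0 T"
  shows "pi00_a (map_prod S T) = pi00_a S \<inter> pi00_a T"
proof -
  have "z \<in> approx_point_spectrum S" "z \<in> approx_point_spectrum T" if "z \<in> sigma_p0 S" for z
  proof -
    have "z \<in> sigma_p0 S" "z \<in> sigma_p0 T"
      using that eq by auto
    then show "z \<in> approx_point_spectrum S" "z \<in> approx_point_spectrum T"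
      using eigenvalue_in_approx_point_spectrum[OF S] eigenvalue_in_approx_point_spectrum[OF T]
      by (auto simp: sigma_p0_def)
  qed
  then show ?thesis
    using eq by (auto simp: pi00_a_def iso_def sigma_p0_map_prod[OF S T eq] isolated_in_Un_iff
        approx_point_spectrum_map_prod[OF S T])
qed

theorem theorem3p9:
  fixes S :: "'a::complex_banach \<Rightarrow> 'a" and T :: "'b::complex_banach \<Rightarrow> 'b"
  assumes "cdim (UNIV :: 'a set) = \<infinity>" and "cdim (UNIV :: 'b set) = \<infinity>"
    and "bounded_clinear S" and "bounded_clinear T"
    and "sigma_p0 S = sigma_p0 T"
    and "property_z S" and "property_z T"
  shows "property_z (map_prod S T) \<longleftrightarrow> sigma_uw (map_prod S T) = sigma_uw S \<union> sigma_uw T"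
proof -
  have S: "Vector_Spaces.linear scaleC scaleC S" and T: "Vector_Spaces.linear scaleC scaleC T"
    using assms(3,4) by (simp_all add: bounded_clinear_def)
  have zS: "spectrum S - sigma_uw S = pi00_a S" and zT: "spectrum T - sigma_uw T = pi00_a T"
    using assms(6,7) by (simp_all add: property_z_def)
  have "pi00_a S \<subseteq> spectrum T" "pi00_a T \<subseteq> spectrum S"
    using sigma_p0_subset_spectrum[OF S] sigma_p0_subset_spectrum[OF T] assms(5)
    by (auto simp: pi00_a_def)
  then have "(spectrum S \<union> spectrum T) - (sigma_uw S \<union> sigma_uw T) = pi00_a S \<inter> pi00_a T"
    using zS zT by blast
  then have "property_z (map_prod S T) \<longleftrightarrow>
      spectrum (map_prod S T) - sigma_uw (map_prod S T) =
      spectrum (map_prod S T) - (sigma_uw S \<union> sigma_uw T)"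
    by (simp add: property_z_def spectrum_map_prod[OF S T] pi00_a_map_prod[OF S T assms(5)])
  also have "\<dots> \<longleftrightarrow> sigma_uw (map_prod S T) = sigma_uw S \<union> sigma_uw T"
    using sigma_uw_map_prod_subset[OF S T] sigma_uw_subset_spectrum[OF S]
      sigma_uw_subset_spectrum[OF T] spectrum_map_prod[OF S T] by blast
  finally show ?thesis .
qed

end
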